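(* Let $n\ge 0$ and let $A$ be a magic-faced hypercube of dimension $n$. If $n$ is even, then $A$ is automatically a magic-faced folded hypercube: when $A$ is viewed as a labeling of the vertices of $FQ_n$, the labels on every $4$-cycle of $FQ_n$ have the same sum. If $n$ is odd, then $A$ is automatically a magic-faced hierarchical folded hypercube: there is a coordinate direction $j\in\{1,\ldots,n\}$ such that, when $A$ is viewed as a labeling of the vertices of $H_jFQ_n$, the labels on every $4$-cycle of $H_jFQ_n$ have the same sum.
   Context: $Q_n$ is the hypercube graph on vertex set $\{0,1\}^n$ (two vertices adjacent iff they differ in exactly one coordinate). A magic-faced hypercube of dimension $n$ is a bijective labeling of the vertices of $Q_n$ by $1,\ldots,2^n$ such that every $4$-cycle of $Q_n$ (equivalently, every $2\times2$ face of the $2\times\cdots\times2$ array) has the same sum of labels. The folded hypercube graph $FQ_n$ is $Q_n$ together with an additional edge joining each pair of antipodal vertices (vertices differing in all $n$ coordinates); $FQ_0$ is a single vertex. For $n\ge1$ and $j\in\{1,\ldots,n\}$, the hierarchical folded hypercube graph $H_jFQ_n$ is $Q_n$ together with additional edges joining, inside each of the two copies of $Q_{n-1}$ obtained by fixing the $j$-th coordinate to be $0$ or $1$, each pair of antipodal vertices of that $Q_{n-1}$ (i.e. vertices agreeing in coordinate $j$ and differing in all other coordinates). All the $H_jFQ_n$ are isomorphic to the Cartesian product of $K_2$ with $FQ_{n-1}$. *)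

theory Defs
  imports Main "HOL-Library.FuncSet"
begin

definition cube :: "nat \<Rightarrow> (nat \<Rightarrow> nat) set" where
  "cube n = {1..n} \<rightarrow>\<^sub>E {0, 1}"

text \<open>Graphs on the vertex set \<^term>\<open>cube n\<close> are given by their adjacency relation.\<close>

definition hypercube_adj :: "nat \<Rightarrow> (nat \<Rightarrow> nat) \<Rightarrow> (nat \<Rightarrow> nat) \<Rightarrow> bool" where
  "hypercube_adj n x y \<longleftrightarrow>
     x \<in> cube n \<and> y \<in> cube n \<and> card {i \<in> {1..n}. x i \<noteq> y i} = 1"

text \<open>The condition \<^prop>\<open>x \<noteq> y\<close> below only excludes a loop at the unique vertex
  of a zero-dimensional cube, which is (vacuously) its own antipode.\<close>

definition folded_hypercube_adj :: "nat \<Rightarrow> (nat \<Rightarrow> nat) \<Rightarrow> (nat \<Rightarrow> nat) \<Rightarrow> bool" where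
  "folded_hypercube_adj n x y \<longleftrightarrow>
     hypercube_adj n x y \<or>
     (x \<in> cube n \<and> y \<in> cube n \<and> x \<noteq> y \<and> (\<forall>i\<in>{1..n}. x i \<noteq> y i))"

definition hierarchical_folded_hypercube_adj ::
    "nat \<Rightarrow> nat \<Rightarrow> (nat \<Rightarrow> nat) \<Rightarrow> (nat \<Rightarrow> nat) \<Rightarrow> bool" where
  "hierarchical_folded_hypercube_adj n j x y \<longleftrightarrow>
     hypercube_adj n x y \<or>
     (x \<in> cube n \<and> y \<in> cube n \<and> x \<noteq> y \<and>
      x j = y j \<and> (\<forall>i\<in>{1..n} - {j}. x i \<noteq> y i))"

text \<open>Cycles are not required to be induced.\<close>

definition four_cycle :: "('v \<Rightarrow> 'v \<Rightarrow> bool) \<Rightarrow> 'v \<Rightarrow> 'v \<Rightarrow> 'v \<Rightarrow> 'v \<Rightarrow> bool" where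
  "four_cycle adj a b c d \<longleftrightarrow>
     distinct [a, b, c, d] \<and> adj a b \<and> adj b c \<and> adj c d \<and> adj d a"

definition equal_four_cycle_sums :: "('v \<Rightarrow> 'v \<Rightarrow> bool) \<Rightarrow> ('v \<Rightarrow> nat) \<Rightarrow> bool" where
  "equal_four_cycle_sums adj A \<longleftrightarrow>
     (\<exists>S. \<forall>a b c d. four_cycle adj a b c d \<longrightarrow> A a + A b + A c + A d = S)"

definition magic_faced_hypercube :: "nat \<Rightarrow> ((nat \<Rightarrow> nat) \<Rightarrow> nat) \<Rightarrow> bool" where
  "magic_faced_hypercube n A \<longleftrightarrow>
     bij_betw A (cube n) {1..2 ^ n} \<and> equal_four_cycle_sums (hypercube_adj n) A"

definition magic_faced_folded_hypercube :: "nat \<Rightarrow> ((nat \<Rightarrow> nat) \<Rightarrow> nat) \<Rightarrow> bool" where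
  "magic_faced_folded_hypercube n A \<longleftrightarrow>
     bij_betw A (cube n) {1..2 ^ n} \<and> equal_four_cycle_sums (folded_hypercube_adj n) A"

definition magic_faced_hierarchical_folded_hypercube ::
    "nat \<Rightarrow> nat \<Rightarrow> ((nat \<Rightarrow> nat) \<Rightarrow> nat) \<Rightarrow> bool" where
  "magic_faced_hierarchical_folded_hypercube n j A \<longleftrightarrow>
     bij_betw A (cube n) {1..2 ^ n} \<and>
     equal_four_cycle_sums (hierarchical_folded_hypercube_adj n j) A"

end

theory Submission imports Defs begin

text \<open>Identify vertices with subsets \<open>X\<close> of \<open>{1..n}\<close>, let \<open>S\<close> be the magic sum and put
  \<open>B X = 4 A X - S\<close>. The face condition says that the mixed second differences of
  \<open>(-1)^|X| B X\<close> vanish, so \<open>B X = (-1)^|X| (c + \<Sum>i\<in>X. d i)\<close>. For a direction set \<open>D\<close> of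
  even size with \<open>d = 0\<close> outside \<open>D\<close>, the sum \<open>B X + B (X \<triangle> D)\<close> is \<open>(-1)^|X|\<close> times a constant,
  so the 4-cycles using the direction \<open>D\<close> sum to \<open>S\<close>. For even \<open>n\<close> take \<open>D = {1..n}\<close>.
  For odd \<open>n > 1\<close> some \<open>d j\<close> vanishes and \<open>D = {1..n} - {j}\<close> works: the values of \<open>B\<close> are
  symmetric about \<open>0\<close>, so their \<open>n\<close>-th powers sum to \<open>0\<close>, whereas that sum is the \<open>n\<close>-th
  mixed difference of an \<open>n\<close>-th power, namely \<open>\<plusminus> n! \<Prod>i. d i\<close>.
  For \<open>n = 1\<close> there are no 4-cycles.\<close>

section \<open>Mixed differences of functions on finite sets\<close>

lemma sum_Pow_insert:
  assumes "finite I" "j \<notin> I"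
  shows "(\<Sum>X\<in>Pow (insert j I). f X) = (\<Sum>X\<in>Pow I. f X) + (\<Sum>X\<in>Pow I. f (insert j X))"
proof -
  have "inj_on (insert j) (Pow I)"
    using assms(2) by (intro inj_onI) (auto simp: insert_ident)
  moreover have "Pow I \<inter> insert j ` Pow I = {}"
    using assms(2) by auto
  ultimately show ?thesis
    using assms(1) by (simp add: Pow_insert sum.union_disjoint sum.reindex)
qed

text \<open>Pairing \<open>X\<close> with \<open>insert j X\<close> leaves a difference of
  \<open>m\<close>-th powers, which has degree below \<open>m\<close> in \<open>c + sum d X\<close>.
  By induction only the exponent \<open>card I\<close> can survive, with coefficient
  \<open>m * d j\<close> when \<open>m\<close> is one larger.\<close>

lemma alternating_sum_power:
  fixes c :: "'b :: {comm_ring_1, semiring_char_0}"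
  assumes "finite I" "m \<le> card I"
  shows "(\<Sum>X\<in>Pow I. (-1) ^ card X * (c + sum d X) ^ m) =
    (if m = card I then (-1) ^ m * fact m * prod d I else 0)"
  using assms
proof (induction I arbitrary: m rule: finite_induct)
  case empty
  then show ?case by simp
next
  case (insert j I)
  have step: "(-1) ^ card X * (c + sum d X) ^ m
      + (-1) ^ card (insert j X) * (c + sum d (insert j X)) ^ m
      = - (\<Sum>k<m. of_nat (m choose k) * d j ^ (m - k) * ((-1) ^ card X * (c + sum d X) ^ k))"
    if "X \<in> Pow I" for X
  proof -
    have X: "finite X" "j \<notin> X"
      using that insert.hyps finite_subset by auto
    have "(c + sum d (insert j X)) ^ m = ((c + sum d X) + d j) ^ m"
      using X by (simp add: algebra_simps)
    also have "\<dots> = (\<Sum>k<m. of_nat (m choose k) * (c + sum d X) ^ k * d j ^ (m - k)) + (c + sum d X) ^ m"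
      by (simp add: binomial_ring lessThan_Suc_atMost[symmetric])
    finally show ?thesis
      using X by (simp add: sum_distrib_left sum_negf algebra_simps)
  qed
  have "(\<Sum>X\<in>Pow (insert j I). (-1) ^ card X * (c + sum d X) ^ m) =
      (\<Sum>X\<in>Pow I. - (\<Sum>k<m. of_nat (m choose k) * d j ^ (m - k) * ((-1) ^ card X * (c + sum d X) ^ k)))"
    unfolding sum_Pow_insert[OF insert.hyps] sum.distrib[symmetric]
    by (intro sum.cong refl step)
  also have "\<dots> = - (\<Sum>k<m. of_nat (m choose k) * d j ^ (m - k)
      * (\<Sum>X\<in>Pow I. (-1) ^ card X * (c + sum d X) ^ k))"
    unfolding sum_negf sum_distrib_left by (subst sum.swap) simp
  also have "\<dots> = - (\<Sum>k<m. of_nat (m choose k) * d j ^ (m - k)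
      * (if k = card I then (-1) ^ k * fact k * prod d I else 0))"
    using insert.prems insert.hyps by (intro arg_cong[where f = uminus] sum.cong) (auto simp: insert.IH)
  also have "\<dots> = (if m = card (insert j I) then (-1) ^ m * fact m * prod d (insert j I) else 0)"
  proof (cases "m = Suc (card I)")
    case True
    then show ?thesis
      using insert.hyps by (simp add: algebra_simps)
  next
    case False
    then show ?thesis
      using insert.hyps insert.prems by (auto intro!: sum.neutral)
  qed
  finally show ?case .
qed

text \<open>The increment of \<open>F\<close> on adding \<open>i\<close> stays the same when another
  \<open>k\<close> joins the set, so it equals the increment at the empty set; adding elements one
  by one sums these increments.\<close>

lemma affine_if_mixed_differences_vanish:
  fixes F :: "'i set \<Rightarrow> 'b :: ab_group_add"
  assumes diff: "\<And>X i k. X \<subseteq> I \<Longrightarrow> i \<in> I - X \<Longrightarrow> k \<in> I - X \<Longrightarrow> i \<noteq> k \<Longrightarrow>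
      F (insert i (insert k X)) + F X = F (insert i X) + F (insert k X)"
    and "finite X" "X \<subseteq> I"
  shows "F X = F {} + (\<Sum>i\<in>X. F {i} - F {})"
proof -
  have increment: "F (insert i X) - F X = F {i} - F {}"
    if "finite X" "X \<subseteq> I" "i \<in> I - X" for X i
    using that
  proof (induction X rule: finite_induct)
    case empty
    then show ?case by simp
  next
    case (insert k X)
    then have "F (insert i (insert k X)) - F (insert k X) = F (insert i X) - F X"
      using diff[of X i k] by (auto simp: algebra_simps)
    with insert show ?case by auto
  qed
  show ?thesis
    using assms(2,3)
  proof (induction X rule: finite_induct)
    case empty
    then show ?case by simp
  next
    case (insert i X)
    then show ?case
      using increment[of X i] by (auto simp: algebra_simps)
  qed
qed

section \<open>Symmetric differences and 4-cycles of subsets\<close>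

lemma sum_sym_diff:
  fixes d :: "'i \<Rightarrow> 'b :: ab_group_add"
  assumes "finite X" "finite D" "\<And>i. i \<in> X - D \<Longrightarrow> d i = 0"
  shows "sum d X + sum d (sym_diff X D) = sum d D"
proof -
  have "sum d X = sum d (X - D) + sum d (X \<inter> D)"
    using assms(1) by (metis add.commute sum.Int_Diff)
  moreover have "sum d (sym_diff X D) = sum d (X - D) + sum d (D - X)"
    using assms(1,2) by (intro sum.union_disjoint) auto
  moreover have "sum d D = sum d (X \<inter> D) + sum d (D - X)"
    using assms(2) by (metis Int_commute sum.Int_Diff)
  moreover have "sum d (X - D) = 0"
    using assms(3) by (intro sum.neutral) auto
  ultimately show ?thesis by simp
qed

lemma sym_diff_eq_iff: "sym_diff X Y = sym_diff Y Z \<longleftrightarrow> X = Z"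
  by blast

lemma mem_sym_diff_singleton: "sym_diff X Y = {i} \<Longrightarrow> l \<in> Y \<longleftrightarrow> (l \<in> X) \<noteq> (l = i)"
  by (cases "l = i") blast+

lemma even_card_sym_diff:
  assumes "finite X" "finite Y"
  shows "even (card (sym_diff X Y)) \<longleftrightarrow> (even (card X) \<longleftrightarrow> even (card Y))"
proof -
  have "card X = card (X - Y) + card (X \<inter> Y)" "card Y = card (Y - X) + card (X \<inter> Y)"
    using assms card_Int_Diff by (metis add.commute, metis Int_commute add.commute)
  moreover have "card (sym_diff X Y) = card (X - Y) + card (Y - X)"
    using assms by (intro card_Un_disjoint) auto
  ultimately show ?thesis by presburger
qed

text \<open>A common model of both folded graphs: \<open>D = I\<close> gives the antipodal edges,
  \<open>D = I - {j}\<close> those inside the two halves. When \<open>D\<close> is empty,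
  \<open>X \<noteq> Y\<close> rules out loops.\<close>

definition step_adj :: "'i set \<Rightarrow> 'i set \<Rightarrow> 'i set \<Rightarrow> 'i set \<Rightarrow> bool" where
  "step_adj I D X Y \<longleftrightarrow> X \<subseteq> I \<and> Y \<subseteq> I \<and> X \<noteq> Y \<and> (card (sym_diff X Y) = 1 \<or> sym_diff X Y = D)"

text \<open>If the four steps were pairwise distinct, three of them would be different singletons,
  and the fourth would have size 3.\<close>

lemma four_cycle_step_adj:
  assumes "four_cycle (step_adj I D) X Y Z W" "even (card D)"
  shows "sym_diff Z W = sym_diff X Y \<and> sym_diff W X = sym_diff Y Z"
proof -
  define P Q R T where PQRT: "P = sym_diff X Y" "Q = sym_diff Y Z" "R = sym_diff Z W" "T = sym_diff W X"
  have steps: "card P = 1 \<or> P = D" "card Q = 1 \<or> Q = D" "card R = 1 \<or> R = D" "card T = 1 \<or> T = D"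
    using assms(1) by (simp_all only: four_cycle_def step_adj_def PQRT)
  \<comment> \<open>If two consecutive steps were equal, two opposite corners of the cycle would
    coincide.\<close>
  have neq: "P \<noteq> Q" "Q \<noteq> R" "R \<noteq> T" "T \<noteq> P"
    using assms(1) sym_diff_eq_iff[of X Y Z] sym_diff_eq_iff[of Y Z W] sym_diff_eq_iff[of Z W X]
      sym_diff_eq_iff[of W X Y] unfolding four_cycle_def PQRT by (simp_all, blast+)
  \<comment> \<open>Going round the cycle flips every element an even number of times.\<close>
  have closed: "i \<in> P \<longleftrightarrow> (i \<in> Q \<longleftrightarrow> (i \<in> R \<longleftrightarrow> i \<in> T))" for i
    unfolding PQRT by blast
  have no_three: False
    if ones: "card U = 1" "card V = 1" "card K = 1" and L_step: "card L = 1 \<or> L = D"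
      and distinct: "U \<noteq> V" "V \<noteq> K" "U \<noteq> K"
      and L: "\<And>i. i \<in> L \<longleftrightarrow> (i \<in> U \<longleftrightarrow> (i \<in> V \<longleftrightarrow> i \<in> K))" for U V K L :: "'a set"
  proof -
    obtain u v k where "U = {u}" "V = {v}" "K = {k}"
      using ones by (meson card_1_singletonE)
    moreover from this have "L = {u, v, k}"
      using distinct by (auto simp: L)
    ultimately have "card L = 3"
      using distinct by auto
    with L_step assms(2) show False by auto
  qed
  have "P = R"
  proof (rule ccontr)
    assume PR: "P \<noteq> R"
    have QT: "Q \<noteq> T"
      using PR closed by blast
    \<comment> \<open>All four steps are now distinct, so at most one is \<open>D\<close>; the cases
      give the role of \<open>L\<close> to the one that may be \<open>D\<close>.\<close>
    show False
    proof (cases "P = D")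
      case True
      show False
        by (rule no_three[of Q R T P]) (use True steps neq PR QT closed in blast)+
    next
      case P: False
      show False
      proof (cases "Q = D")
        case True
        show False
          by (rule no_three[of P R T Q]) (use True steps neq PR QT P closed in blast)+
      next
        case Q: False
        show False
        proof (cases "R = D")
          case True
          show False
            by (rule no_three[of P Q T R]) (use True steps neq PR QT P Q closed in blast)+
        next
          case False
          show False
            by (rule no_three[of P Q R T]) (use False steps neq PR QT P Q closed in blast)+
        qed
      qed
    qed
  qed
  moreover from this have "Q = T"
    using closed by blast
  ultimately show ?thesis
    unfolding PQRT by simp
qed

text \<open>Opposite steps agree, so the cycle is a parallelogram. If one direction is
  \<open>D\<close>, the two \<open>D\<close>-edges have pair sums equal up to sign, and the
  singleton step between them makes the signs opposite. Otherwise the cycle is a face and the slopes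
  cancel. The guard \<open>D \<noteq> {}\<close> admits nonzero slopes when no edge has direction
  \<open>D\<close>.\<close>

lemma magic_sum_step_adj:
  fixes B :: "'i set \<Rightarrow> int"
  assumes "finite I" "D \<subseteq> I" "even (card D)"
    and B: "\<And>X. X \<subseteq> I \<Longrightarrow> B X = (-1) ^ card X * (c + sum d X)"
    and d: "\<And>i. D \<noteq> {} \<Longrightarrow> i \<in> I - D \<Longrightarrow> d i = 0"
    and cycle: "four_cycle (step_adj I D) X Y Z W"
  shows "B X + B Y + B Z + B W = 0"
proof -
  note fin = finite_subset[OF _ \<open>finite I\<close>]
  have sub: "X \<subseteq> I" "Y \<subseteq> I" "Z \<subseteq> I" "W \<subseteq> I"
    and neq: "X \<noteq> Y" "Y \<noteq> Z" "Z \<noteq> W" "W \<noteq> X" "X \<noteq> Z"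
    and steps: "card (sym_diff X Y) = 1 \<or> sym_diff X Y = D" "card (sym_diff Y Z) = 1 \<or> sym_diff Y Z = D"
    using cycle unfolding four_cycle_def step_adj_def by auto
  have sd: "sym_diff Z W = sym_diff X Y" "sym_diff W X = sym_diff Y Z"
    using four_cycle_step_adj[OF cycle \<open>even (card D)\<close>] by blast+
  have sign: "(-1) ^ card V = (- ((-1) ^ card U) :: int)"
    if "U \<subseteq> I" "V \<subseteq> I" "card (sym_diff U V) = 1" for U V
  proof -
    have "even (card U) \<longleftrightarrow> odd (card V)"
      using even_card_sym_diff[of U V] that fin by auto
    then show ?thesis by (auto simp: uminus_power_if)
  qed
  \<comment> \<open>An even \<open>D\<close> keeps the sign, and \<open>sum d U + sum d V\<close> is
    \<open>sum d D\<close> whatever \<open>U\<close> is, so the pair sum depends on \<open>U\<close>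
    only through its parity.\<close>
  have pair: "B U + B V = (-1) ^ card U * (2 * c + sum d D)"
    if UV: "U \<subseteq> I" "V \<subseteq> I" "U \<noteq> V" "sym_diff U V = D" for U V
  proof -
    have V: "V = sym_diff U D" and D: "D \<noteq> {}"
      using UV by blast+
    have "even (card U) \<longleftrightarrow> even (card V)"
      using even_card_sym_diff[of U V] UV fin \<open>even (card D)\<close> by simp
    then have "(-1) ^ card V = ((-1) ^ card U :: int)"
      by (auto simp: uminus_power_if)
    then have "B U + B V = (-1) ^ card U * (2 * c + (sum d U + sum d V))"
      using UV(1,2) by (simp add: B algebra_simps)
    also have "sum d U + sum d V = sum d D"
      unfolding V using UV(1) D d fin \<open>D \<subseteq> I\<close> by (intro sum_sym_diff) auto
    finally show ?thesis .
  qed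
  \<comment> \<open>Both steps being \<open>D\<close> would give \<open>X = Z\<close>.\<close>
  consider "sym_diff X Y = D" "card (sym_diff Y Z) = 1" | "sym_diff Y Z = D" "card (sym_diff X Y) = 1"
    | "card (sym_diff X Y) = 1" "card (sym_diff Y Z) = 1"
    using steps neq by blast
  then show ?thesis
  proof cases
    case 1
    then show ?thesis
      using pair[of X Y] pair[of W Z] sign[of X W] sub neq sd by (simp add: Un_commute)
  next
    case 2
    then show ?thesis
      using pair[of Y Z] pair[of X W] sign[of X Y] sub neq sd by (simp add: Un_commute)
  next
    case 3
    obtain i k where i: "sym_diff X Y = {i}" and k: "sym_diff Y Z = {k}"
      using 3 by (meson card_1_singletonE)
    \<comment> \<open>Sums over all of \<open>I\<close> allow the parallelogram identity to be
      checked one element \<open>l\<close> at a time.\<close>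
    have sum_indicator: "sum d U = (\<Sum>l\<in>I. if l \<in> U then d l else 0)" if "U \<subseteq> I" for U
      using that \<open>finite I\<close> by (simp add: sum.inter_restrict[symmetric] inf.absorb2)
    have "(if l \<in> X then d l else 0) + (if l \<in> Z then d l else 0)
        = (if l \<in> Y then d l else 0) + (if l \<in> W then d l else 0)" for l
    proof -
      have "i \<noteq> k"
        using i k \<open>X \<noteq> Z\<close> sym_diff_eq_iff[of X Y Z] by simp
      then show ?thesis
        using mem_sym_diff_singleton[OF i, of l] mem_sym_diff_singleton[OF k, of l]
          mem_sym_diff_singleton[OF sd(1)[unfolded i], of l] by auto
    qed
    then have "sum d X + sum d Z = sum d Y + sum d W"
      using sub by (simp add: sum_indicator flip: sum.distrib)
    moreover have "(-1) ^ card Y = (- ((-1) ^ card X) :: int)"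
      "(-1) ^ card Z = ((-1) ^ card X :: int)" "(-1) ^ card W = (- ((-1) ^ card X) :: int)"
      using sign[of X Y] sign[of Y Z] sign[of X W] 3 sub sd by (simp_all add: Un_commute)
    then have "B X + B Y + B Z + B W =
        (-1) ^ card X * ((sum d X + sum d Z) - (sum d Y + sum d W))"
      using sub by (simp add: B algebra_simps)
    ultimately show ?thesis by simp
  qed
qed

section \<open>Translation between 0-1 vectors and subsets\<close>

definition vertex :: "nat \<Rightarrow> nat set \<Rightarrow> nat \<Rightarrow> nat" where
  "vertex n X = (\<lambda>i\<in>{1..n}. if i \<in> X then 1 else 0)"

definition ones :: "nat \<Rightarrow> (nat \<Rightarrow> nat) \<Rightarrow> nat set" where
  "ones n x = {i \<in> {1..n}. x i = 1}"

lemma cube_values: "x \<in> cube n \<Longrightarrow> i \<in> {1..n} \<Longrightarrow> x i = 0 \<or> x i = 1"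
  unfolding cube_def by blast

lemma vertex_in_cube: "vertex n X \<in> cube n"
  by (auto simp: vertex_def cube_def)

lemma vertex_ones: "x \<in> cube n \<Longrightarrow> vertex n (ones n x) = x"
  using cube_values[of x n] by (fastforce simp: vertex_def ones_def cube_def PiE_def extensional_def)

lemma ones_vertex: "X \<subseteq> {1..n} \<Longrightarrow> ones n (vertex n X) = X"
  by (auto simp: vertex_def ones_def split: if_splits)

lemma bij_betw_vertex: "bij_betw (vertex n) (Pow {1..n}) (cube n)"
  by (rule bij_betw_byWitness[where f' = "ones n"])
    (auto simp: vertex_ones ones_vertex vertex_in_cube, auto simp: ones_def)

lemma sym_diff_ones:
  assumes "x \<in> cube n" "y \<in> cube n"
  shows "sym_diff (ones n x) (ones n y) = {i \<in> {1..n}. x i \<noteq> y i}"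
  using cube_values[OF assms(1)] cube_values[OF assms(2)] unfolding ones_def by fastforce

lemma hypercube_adj_vertex:
  assumes "X \<subseteq> {1..n}" "Y \<subseteq> {1..n}"
  shows "hypercube_adj n (vertex n X) (vertex n Y) \<longleftrightarrow> card (sym_diff X Y) = 1"
  using sym_diff_ones[of "vertex n X" n "vertex n Y"] assms
  by (simp add: hypercube_adj_def vertex_in_cube ones_vertex)

lemma ones_eq_iff: "x \<in> cube n \<Longrightarrow> y \<in> cube n \<Longrightarrow> ones n x = ones n y \<longleftrightarrow> x = y"
  by (metis vertex_ones)

lemma step_adj_ones:
  assumes "x \<in> cube n" "y \<in> cube n" "x \<noteq> y"
    and "card {i \<in> {1..n}. x i \<noteq> y i} = 1 \<or> {i \<in> {1..n}. x i \<noteq> y i} = D"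
  shows "step_adj {1..n} D (ones n x) (ones n y)"
  using assms ones_eq_iff[of x n y] unfolding step_adj_def
  by (simp add: sym_diff_ones) (auto simp: ones_def)

lemma hypercube_adj_neq: "hypercube_adj n x y \<Longrightarrow> x \<noteq> y"
  by (auto simp: hypercube_adj_def)

lemma folded_hypercube_adj_step:
  assumes "folded_hypercube_adj n x y"
  shows "x \<in> cube n \<and> step_adj {1..n} {1..n} (ones n x) (ones n y)"
proof -
  have "x \<in> cube n" "y \<in> cube n" "x \<noteq> y"
    using assms hypercube_adj_neq unfolding folded_hypercube_adj_def hypercube_adj_def by blast+
  moreover have "card {i \<in> {1..n}. x i \<noteq> y i} = 1 \<or> {i \<in> {1..n}. x i \<noteq> y i} = {1..n}"
    using assms unfolding folded_hypercube_adj_def hypercube_adj_def by blast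
  ultimately show ?thesis
    by (intro conjI step_adj_ones)
qed

lemma hierarchical_folded_hypercube_adj_step:
  assumes "hierarchical_folded_hypercube_adj n j x y"
  shows "x \<in> cube n \<and> step_adj {1..n} ({1..n} - {j}) (ones n x) (ones n y)"
proof -
  have "x \<in> cube n" "y \<in> cube n" "x \<noteq> y"
    using assms hypercube_adj_neq
    unfolding hierarchical_folded_hypercube_adj_def hypercube_adj_def by blast+
  moreover have "card {i \<in> {1..n}. x i \<noteq> y i} = 1 \<or> {i \<in> {1..n}. x i \<noteq> y i} = {1..n} - {j}"
    using assms unfolding hierarchical_folded_hypercube_adj_def hypercube_adj_def by blast
  ultimately show ?thesis
    by (intro conjI step_adj_ones)
qed

text \<open>The witness for the common sum is \<open>S\<close>: the centred labels around a cycle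
  cancel, so four times the label sum is \<open>4 * S\<close>. Cycles of \<open>adj\<close> are only
  mapped forward to cycles of \<open>step_adj\<close>.\<close>

lemma equal_four_cycle_sums_step_adj:
  fixes A :: "(nat \<Rightarrow> nat) \<Rightarrow> nat" and S :: nat
  assumes "D \<subseteq> {1..n}" "even (card D)"
    and B: "\<And>X. X \<subseteq> {1..n} \<Longrightarrow>
      4 * int (A (vertex n X)) - int S = (-1) ^ card X * (c + sum d X)"
    and d: "\<And>i. D \<noteq> {} \<Longrightarrow> i \<in> {1..n} - D \<Longrightarrow> d i = 0"
    and adj: "\<And>x y. adj x y \<Longrightarrow> x \<in> cube n \<and> step_adj {1..n} D (ones n x) (ones n y)"
  shows "equal_four_cycle_sums adj A"
  unfolding equal_four_cycle_sums_def
proof (intro exI allI impI)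
  fix x y z w
  assume cycle: "four_cycle adj x y z w"
  then have cube: "x \<in> cube n" "y \<in> cube n" "z \<in> cube n" "w \<in> cube n"
    using adj unfolding four_cycle_def by blast+
  with cycle have "four_cycle (step_adj {1..n} D) (ones n x) (ones n y) (ones n z) (ones n w)"
    using adj unfolding four_cycle_def by (auto simp: ones_eq_iff)
  from magic_sum_step_adj[OF _ assms(1,2) B d this]
  show "A x + A y + A z + A w = S"
    using cube by (simp add: vertex_ones)
qed

section \<open>Affine form of the labels and a vanishing slope\<close>

lemma magic_faced_hypercube_affine:
  assumes "equal_four_cycle_sums (hypercube_adj n) A"
  obtains S :: nat and c d where
    "\<And>X. X \<subseteq> {1..n} \<Longrightarrow> 4 * int (A (vertex n X)) - int S = (-1) ^ card X * (c + sum d X)"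
proof -
  from assms obtain S where
    S: "\<And>x y z w. four_cycle (hypercube_adj n) x y z w \<Longrightarrow> A x + A y + A z + A w = S"
    unfolding equal_four_cycle_sums_def by blast
  \<comment> \<open>Scaling by 4 avoids dividing \<open>S\<close> by 4, and the sign turns a zero
    sum over a face into a vanishing mixed difference.\<close>
  define F where "F X = (-1) ^ card X * (4 * int (A (vertex n X)) - int S)" for X
  have "F (insert i (insert k X)) + F X = F (insert i X) + F (insert k X)"
    if "X \<subseteq> {1..n}" "i \<in> {1..n} - X" "k \<in> {1..n} - X" "i \<noteq> k" for X i k
  proof -
    have one: "hypercube_adj n (vertex n U) (vertex n V)"
      if "U \<subseteq> {1..n}" "V \<subseteq> {1..n}" "sym_diff U V = {l}" for U V l
      using that by (simp only: hypercube_adj_vertex) simp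
    have diffs: "sym_diff X (insert i X) = {i}" "sym_diff (insert i X) (insert i (insert k X)) = {k}"
      "sym_diff (insert i (insert k X)) (insert k X) = {i}" "sym_diff (insert k X) X = {k}"
      using that by auto
    have "distinct [X, insert i X, insert i (insert k X), insert k X]"
      using that by auto
    then have "distinct [vertex n X, vertex n (insert i X), vertex n (insert i (insert k X)),
        vertex n (insert k X)]"
      using that bij_betw_imp_inj_on[OF bij_betw_vertex[of n]] by (simp add: inj_on_eq_iff)
    then have "four_cycle (hypercube_adj n) (vertex n X) (vertex n (insert i X))
        (vertex n (insert i (insert k X))) (vertex n (insert k X))"
      using that unfolding four_cycle_def by (auto intro!: one diffs)
    from S[OF this] have "int (A (vertex n X)) + int (A (vertex n (insert i X)))
        + int (A (vertex n (insert i (insert k X)))) + int (A (vertex n (insert k X))) = int S"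
      by linarith
    moreover have "finite X"
      using that(1) finite_subset by blast
    then have "F (insert i (insert k X)) + F X - (F (insert i X) + F (insert k X)) =
        (-1) ^ card X * (4 * (int (A (vertex n X)) + int (A (vertex n (insert i X)))
          + int (A (vertex n (insert i (insert k X)))) + int (A (vertex n (insert k X)))) - 4 * int S)"
      using that by (simp add: F_def algebra_simps)
    ultimately show ?thesis by simp
  qed
  from affine_if_mixed_differences_vanish[of "{1..n}" F, OF this]
  have "F X = F {} + (\<Sum>i\<in>X. F {i} - F {})" if "X \<subseteq> {1..n}" for X
    using that finite_subset by blast
  moreover have "4 * int (A (vertex n X)) - int S = (-1) ^ card X * F X" for X
    unfolding F_def mult.assoc[symmetric] power_add[symmetric] by simp
  ultimately show thesis
    using that[of S "F {}" "\<lambda>i. F {i} - F {}"] by metis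
qed

text \<open>Two moments of the centred labels matter: the first, zero because \<open>1 < n\<close>,
  fixes \<open>S\<close>; the \<open>n\<close>-th is then zero by symmetry, but it is also a nonzero
  multiple of \<open>prod d {1..n}\<close>.\<close>

lemma zero_slope_if_odd:
  assumes "odd n" "n \<noteq> 1" "bij_betw A (cube n) {1..2 ^ n}"
    and B: "\<And>X. X \<subseteq> {1..n} \<Longrightarrow>
      4 * int (A (vertex n X)) - int S = (-1) ^ card X * (c + sum d X)"
  shows "\<exists>j\<in>{1..n}. d j = 0"
proof -
  define N :: nat where "N = 2 ^ n"
  have bij: "bij_betw (A \<circ> vertex n) (Pow {1..n}) {1..N}"
    using bij_betw_trans[OF bij_betw_vertex assms(3)] unfolding N_def .
  \<comment> \<open>An odd power preserves the sign \<open>(-1) ^ card X\<close>, so the moment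
    becomes an alternating sum of powers.\<close>
  have moment: "(\<Sum>a\<in>{1..N}. (4 * int a - int S) ^ m) =
      (if m = n then (-1) ^ m * fact m * prod d {1..n} else 0)" if "odd m" "m \<le> n" for m
  proof -
    have "(\<Sum>a\<in>{1..N}. (4 * int a - int S) ^ m) =
        (\<Sum>X\<in>Pow {1..n}. (4 * int (A (vertex n X)) - int S) ^ m)"
      using sum.reindex_bij_betw[OF bij, of "\<lambda>a. (4 * int a - int S) ^ m"] by simp
    also have "\<dots> = (\<Sum>X\<in>Pow {1..n}. (-1) ^ card X * (c + sum d X) ^ m)"
      using \<open>odd m\<close> by (intro sum.cong) (auto simp: B power_mult_distrib uminus_power_if)
    finally show ?thesis
      using alternating_sum_power[of "{1..n}" m c d] that by simp
  qed
  have reflect: "(\<Sum>a\<in>{1..N}. f a) = (\<Sum>a\<in>{1..N}. f (N + 1 - a))" for f :: "nat \<Rightarrow> int"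
    by (rule sum.reindex_bij_witness[of _ "\<lambda>a. N + 1 - a" "\<lambda>a. N + 1 - a"]) auto
  \<comment> \<open>Adding the first moment to its reflection pins down \<open>S\<close> as four
    times the mean label.\<close>
  have "(\<Sum>a\<in>{1..N}. 4 * int a - int S) = 0"
    using moment[of 1] assms(1,2) by (cases n) auto
  moreover have "(\<Sum>a\<in>{1..N}. 4 * int a - int S) + (\<Sum>a\<in>{1..N}. 4 * int (N + 1 - a) - int S)
      = (\<Sum>a\<in>{1..N}. 4 * int (N + 1) - 2 * int S)"
    unfolding sum.distrib[symmetric] by (intro sum.cong) (auto simp: of_nat_diff)
  ultimately have "int N * (4 * int (N + 1) - 2 * int S) = 0"
    using reflect[of "\<lambda>a. 4 * int a - int S"] by simp
  then have S: "int S = 2 * int (N + 1)"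
    by (simp add: N_def)
  \<comment> \<open>Replacing \<open>a\<close> by \<open>N + 1 - a\<close> negates the centred
    label, and an odd power keeps that sign.\<close>
  have "(\<Sum>a\<in>{1..N}. (4 * int (N + 1 - a) - int S) ^ n) = (\<Sum>a\<in>{1..N}. - ((4 * int a - int S) ^ n))"
  proof (intro sum.cong refl)
    fix a assume "a \<in> {1..N}"
    then have "4 * int (N + 1 - a) - int S = - (4 * int a - int S)"
      by (simp add: S of_nat_diff)
    then show "(4 * int (N + 1 - a) - int S) ^ n = - ((4 * int a - int S) ^ n)"
      using \<open>odd n\<close> by (metis power_minus_odd)
  qed
  then have "(\<Sum>a\<in>{1..N}. (4 * int a - int S) ^ n) = 0"
    using reflect[of "\<lambda>a. (4 * int a - int S) ^ n"] by (simp add: sum_negf)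
  then have "prod d {1..n} = 0"
    using moment[of n] assms(1) by simp
  then show ?thesis
    by simp
qed

theorem theorem2:
  fixes n :: nat and A :: "(nat \<Rightarrow> nat) \<Rightarrow> nat"
  assumes "magic_faced_hypercube n A"
  shows "(even n \<longrightarrow> magic_faced_folded_hypercube n A) \<and>
         (odd n \<longrightarrow> (\<exists>j\<in>{1..n}. magic_faced_hierarchical_folded_hypercube n j A))"
proof -
  have bij: "bij_betw A (cube n) {1..2 ^ n}"
    and sums: "equal_four_cycle_sums (hypercube_adj n) A"
    using assms unfolding magic_faced_hypercube_def by blast+
  from sums obtain S c d where B: "\<And>X. X \<subseteq> {1..n} \<Longrightarrow>
      4 * int (A (vertex n X)) - int S = (-1) ^ card X * (c + sum d X)"
    by (rule magic_faced_hypercube_affine) blast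
  show ?thesis
  proof (intro conjI impI)
    assume "even n"
    \<comment> \<open>With \<open>D = {1..n}\<close> no index lies outside \<open>D\<close>, so no
      slope has to vanish.\<close>
    then have "equal_four_cycle_sums (folded_hypercube_adj n) A"
      by (intro equal_four_cycle_sums_step_adj[OF _ _ B _ folded_hypercube_adj_step]) auto
    then show "magic_faced_folded_hypercube n A"
      using bij unfolding magic_faced_folded_hypercube_def by blast
  next
    assume "odd n"
    \<comment> \<open>For \<open>n = 1\<close> the only choice is \<open>j = 1\<close>, whose slope
      may be nonzero; there \<open>{1..n} - {j}\<close> is empty, so the condition on the slopes
      holds vacuously.\<close>
    obtain j where j: "j \<in> {1..n}" "n \<noteq> 1 \<Longrightarrow> d j = 0"
    proof (cases "n = 1")
      case True
      then show ?thesis using that[of 1] by simp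
    next
      case False
      then show ?thesis using that zero_slope_if_odd[OF \<open>odd n\<close> _ bij B] by blast
    qed
    have "equal_four_cycle_sums (hierarchical_folded_hypercube_adj n j) A"
    proof (rule equal_four_cycle_sums_step_adj[OF _ _ B _ hierarchical_folded_hypercube_adj_step])
      show "even (card ({1..n} - {j}))"
        using \<open>odd n\<close> j by simp
      show "d i = 0" if "{1..n} - {j} \<noteq> {}" "i \<in> {1..n} - ({1..n} - {j})" for i
        using that j by (cases "n = 1") auto
    qed auto
    then show "\<exists>j\<in>{1..n}. magic_faced_hierarchical_folded_hypercube n j A"
      using bij j unfolding magic_faced_hierarchical_folded_hypercube_def by blast
  qed
qed

end
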